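(* Let $\gamma \geq 2$ and $n \geq 3\gamma$ be integers. Let $\mathcal{G}_{n,\gamma}$ be the set of all simple graphs without isolated vertices having order $n$, domination number $\gamma$, and exactly one minimum dominating set. Then there exists a perfectly dominated graph $G \in \mathcal{G}_{n,\gamma}$ with exactly $$\binom{n-\gamma}{2} - \gamma(\gamma-2)$$ edges.
   Context: A dominating set of a graph $G=(V,E)$ is a set $D\subseteq V$ such that every vertex of $V\setminus D$ is adjacent to some vertex of $D$; the domination number $\gamma(G)$ is the minimum size of a dominating set, and a minimum dominating set is one of size $\gamma(G)$. A simple graph $G$ without isolated vertices, of order $n$ and domination number $\gamma$, is perfectly dominated if it has a minimum dominating set $D$ with $\sum_{x\in D}\deg(x) = n-\gamma$ (equivalently, $D$ is independent and every vertex outside $D$ is adjacent to exactly one vertex of $D$). *)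

theory Defs
  imports Main
begin

definition simple_graph :: "'a set \<Rightarrow> 'a set set \<Rightarrow> bool" where
  "simple_graph V E \<longleftrightarrow> finite V \<and> E \<subseteq> {e. e \<subseteq> V \<and> card e = 2}"

definition degree :: "'a set \<Rightarrow> 'a set set \<Rightarrow> 'a \<Rightarrow> nat" where
  "degree V E x = card {y \<in> V. {x, y} \<in> E}"

definition no_isolated_vertices :: "'a set \<Rightarrow> 'a set set \<Rightarrow> bool" where
  "no_isolated_vertices V E \<longleftrightarrow> (\<forall>x\<in>V. \<exists>y\<in>V. {x, y} \<in> E)"

definition dominating_set :: "'a set \<Rightarrow> 'a set set \<Rightarrow> 'a set \<Rightarrow> bool" where
  "dominating_set V E D \<longleftrightarrow> D \<subseteq> V \<and> (\<forall>v \<in> V - D. \<exists>u\<in>D. {u, v} \<in> E)"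

definition domination_number :: "'a set \<Rightarrow> 'a set set \<Rightarrow> nat" where
  "domination_number V E = Min (card ` {D. dominating_set V E D})"

definition minimum_dominating_set :: "'a set \<Rightarrow> 'a set set \<Rightarrow> 'a set \<Rightarrow> bool" where
  "minimum_dominating_set V E D \<longleftrightarrow>
     dominating_set V E D \<and> card D = domination_number V E"

text \<open>Since \<open>V\<close> is itself a dominating set, the domination number is at most \<open>card V\<close>,
  so the subtraction on \<open>nat\<close> below does not truncate.\<close>

definition perfectly_dominated :: "'a set \<Rightarrow> 'a set set \<Rightarrow> bool" where
  "perfectly_dominated V E \<longleftrightarrow>
     simple_graph V E \<and> no_isolated_vertices V E \<and>
     (\<exists>D. minimum_dominating_set V E D \<and>
          (\<Sum>x\<in>D. degree V E x) = card V - domination_number V E)"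

definition unique_mds_graphs :: "nat \<Rightarrow> nat \<Rightarrow> ('a set \<times> 'a set set) set" where
  "unique_mds_graphs n \<gamma> =
     {(V, E). simple_graph V E \<and> no_isolated_vertices V E \<and>
        card V = n \<and> domination_number V E = \<gamma> \<and>
        (\<exists>!D. minimum_dominating_set V E D)}"

end

theory Submission
  imports Defs
begin

text \<open>
  Take vertices \<open>x\<^sub>i\<close>, \<open>c\<^sub>i\<close> (\<open>i < \<gamma>\<close>) and \<open>l\<^sub>t\<close> (\<open>t < n - 2\<gamma>\<close>), put \<open>l\<^sub>t\<close> into class
  \<open>min t (\<gamma> - 1)\<close> and \<open>x\<^sub>i\<close>, \<open>c\<^sub>i\<close> into class \<open>i\<close>. Each \<open>x\<^sub>i\<close> is joined to the rest of its class, the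
  \<open>l\<^sub>t\<close> form a clique, and \<open>c\<^sub>i\<close> is joined to \<open>l\<^sub>t\<close> iff \<open>i\<close> is less than the class of \<open>l\<^sub>t\<close>.
  The classes are the closed neighbourhoods of the \<open>x\<^sub>i\<close>, so a dominating set meets every class and a
  dominating set \<open>S\<close> of size \<open>\<gamma>\<close> is a transversal of the classes. If \<open>S\<close> contains some \<open>l\<^sub>t\<close>, let
  \<open>k\<close> be the largest class of such a vertex: then \<open>c\<^sub>k\<close> is not dominated. If it contains no
  \<open>l\<^sub>t\<close> but some \<open>c\<^sub>i\<close>, let \<open>k\<close> be the least such index: then \<open>l\<^sub>k\<close> is not dominated. Hence
  \<open>S\<close> consists of the \<open>x\<^sub>i\<close>.
\<close>

text \<open>The vertices \<open>x\<^sub>i\<close>, \<open>c\<^sub>i\<close>, \<open>l\<^sub>t\<close> are encoded as \<open>i\<close>, \<open>\<gamma> + i\<close>, \<open>2\<gamma> + t\<close>.\<close>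

definition vertex_class :: "nat \<Rightarrow> nat \<Rightarrow> nat" where
  "vertex_class \<gamma> v =
     (if v < \<gamma> then v else if v < 2 * \<gamma> then v - \<gamma> else min (v - 2 * \<gamma>) (\<gamma> - 1))"

text \<open>Each edge is recorded at its larger endpoint only. In the last case the three sets are
  the edges from \<open>l\<^sub>t\<close> to the \<open>x\<^sub>i\<close> of its class, to the
  \<open>c\<^sub>i\<close> of smaller index and to the earlier \<open>l\<^sub>s\<close>.\<close>

definition lower_nbrs :: "nat \<Rightarrow> nat \<Rightarrow> nat set" where
  "lower_nbrs \<gamma> v =
     (if v < \<gamma> then {}
      else if v < 2 * \<gamma> then {vertex_class \<gamma> v}
      else {vertex_class \<gamma> v} \<union> {\<gamma>..<\<gamma> + vertex_class \<gamma> v} \<union> {2 * \<gamma>..<v})"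

definition class_graph_edges :: "nat \<Rightarrow> nat \<Rightarrow> nat set set" where
  "class_graph_edges n \<gamma> = {{u, v} | u v. v < n \<and> u \<in> lower_nbrs \<gamma> v}"

lemma vertex_class_less: "0 < \<gamma> \<Longrightarrow> vertex_class \<gamma> v < \<gamma>"
  by (auto simp: vertex_class_def)

lemma lower_nbrs_less: "0 < \<gamma> \<Longrightarrow> u \<in> lower_nbrs \<gamma> v \<Longrightarrow> u < v"
  using vertex_class_less[of \<gamma> v] by (auto simp: lower_nbrs_def split: if_splits)

lemma class_graph_edge_iff:
  "{u, v} \<in> class_graph_edges n \<gamma> \<longleftrightarrow>
     v < n \<and> u \<in> lower_nbrs \<gamma> v \<or> u < n \<and> v \<in> lower_nbrs \<gamma> u"
  by (auto simp: class_graph_edges_def doubleton_eq_iff)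

lemma simple_class_graph:
  assumes "0 < \<gamma>"
  shows "simple_graph {..<n} (class_graph_edges n \<gamma>)"
proof -
  have "{u, v} \<subseteq> {..<n} \<and> card {u, v} = 2" if "v < n" "u \<in> lower_nbrs \<gamma> v" for u v
    using that lower_nbrs_less[OF assms that(2)] by auto
  then show ?thesis
    unfolding simple_graph_def class_graph_edges_def by blast
qed

text \<open>The class of \<open>v\<close> is the only number below \<gamma> in
  \<open>lower_nbrs \<gamma> v\<close> when \<open>\<gamma> \<le> v\<close>. This is what makes the
  classes the closed neighbourhoods of the \<open>x\<^sub>i\<close>.\<close>

lemma class_graph_edge_small_iff:
  assumes "i < \<gamma>" and "v < n"
  shows "{i, v} \<in> class_graph_edges n \<gamma> \<longleftrightarrow> \<gamma> \<le> v \<and> vertex_class \<gamma> v = i"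
  using assms by (auto simp: class_graph_edge_iff lower_nbrs_def)

section \<open>The number of edges\<close>

lemma card_class_graph_edges:
  assumes "0 < \<gamma>"
  shows "card (class_graph_edges n \<gamma>) = (\<Sum>v<n. card (lower_nbrs \<gamma> v))"
proof -
  let ?A = "SIGMA v:{..<n}. lower_nbrs \<gamma> v"
  have "class_graph_edges n \<gamma> = (\<lambda>(v, u). {u, v}) ` ?A"
    by (force simp: class_graph_edges_def)
  \<comment> \<open>Since \<open>u < v\<close>, the unordered edge determines the ordered
    pair.\<close>
  moreover have "inj_on (\<lambda>(v, u). {u, v}) ?A"
    by (auto simp: inj_on_def doubleton_eq_iff dest: lower_nbrs_less[OF assms] less_asym)
  ultimately have "card (class_graph_edges n \<gamma>) = card ?A"
    by (simp add: card_image)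
  also have "\<dots> = (\<Sum>v<n. card (lower_nbrs \<gamma> v))"
    by (rule card_SigmaI) (auto simp: lower_nbrs_def)
  finally show ?thesis .
qed

lemma card_lower_nbrs_large:
  assumes "0 < \<gamma>"
  shows "card (lower_nbrs \<gamma> (2 * \<gamma> + t)) = 1 + min t (\<gamma> - 1) + t"
proof -
  let ?c = "min t (\<gamma> - 1)"
  have "lower_nbrs \<gamma> (2 * \<gamma> + t) = insert ?c ({\<gamma>..<\<gamma> + ?c} \<union> {2 * \<gamma>..<2 * \<gamma> + t})"
    using assms by (auto simp: lower_nbrs_def vertex_class_def)
  moreover have "card ({\<gamma>..<\<gamma> + ?c} \<union> {2 * \<gamma>..<2 * \<gamma> + t}) = ?c + t"
    using assms by (subst card_Un_disjoint) auto
  moreover have "?c \<notin> {\<gamma>..<\<gamma> + ?c} \<union> {2 * \<gamma>..<2 * \<gamma> + t}"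
    using assms by auto
  ultimately show ?thesis
    by simp
qed

lemma sum_card_lower_nbrs:
  assumes "0 < \<gamma>"
  shows "(\<Sum>v<2 * \<gamma> + q. card (lower_nbrs \<gamma> v)) = \<gamma> + (\<Sum>t<q. 1 + min t (\<gamma> - 1) + t)"
proof (induction q)
  case 0
  \<comment> \<open>Only the \<gamma> edges between \<open>c\<^sub>i\<close> and
    \<open>x\<^sub>i\<close> lie below \<open>2 * \<gamma>\<close>.\<close>
  have "(\<Sum>v<2 * \<gamma>. card (lower_nbrs \<gamma> v)) = (\<Sum>v\<in>{\<gamma>..<2 * \<gamma>}. 1)"
    by (rule sum.mono_neutral_cong_right) (auto simp: lower_nbrs_def)
  then show ?case by simp
next
  case (Suc q)
  then show ?case using card_lower_nbrs_large[OF assms, of q] by simp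
qed

lemma card_class_graph_edges_eq:
  assumes "0 < \<gamma>" and "3 * \<gamma> \<le> n"
  shows "int (card (class_graph_edges n \<gamma>)) = int ((n - \<gamma>) choose 2) - int \<gamma> * (int \<gamma> - 2)"
proof -
  obtain k where k: "n = 3 * \<gamma> + k"
    using assms(2) le_Suc_ex by blast
  have two: "2 * int (m choose 2) = int m * (int m - 1)" for m
    by (induction m) (auto simp: numeral_2_eq_2 algebra_simps)
  \<comment> \<open>Here the minimum is \<open>t\<close>, so the terms are the odd numbers
    \<open>2 * t + 1\<close>.\<close>
  have small: "(\<Sum>t<j. 1 + min t (\<gamma> - 1) + t) = j * j" if "j \<le> \<gamma>" for j
    using that by (induction j) auto
  \<comment> \<open>Doubling avoids the division in the binomial coefficient. From
    \<open>t = \<gamma>\<close> on the minimum stays at \<open>\<gamma> - 1\<close>.\<close>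
  have "2 * int (\<Sum>t<\<gamma> + k. 1 + min t (\<gamma> - 1) + t) =
      2 * int \<gamma> * int \<gamma> + int k * (4 * int \<gamma> + int k - 1)"
  proof (induction k)
    case 0
    show ?case by (simp only: small[OF order_refl] add_0_right) simp
  next
    case (Suc k)
    have "int (1 + min (\<gamma> + k) (\<gamma> - 1) + (\<gamma> + k)) = 2 * int \<gamma> + int k"
      using assms(1) by (simp add: min_def)
    with Suc show ?case by (simp add: algebra_simps)
  qed
  moreover have "card (class_graph_edges n \<gamma>) = \<gamma> + (\<Sum>t<\<gamma> + k. 1 + min t (\<gamma> - 1) + t)"
    using card_class_graph_edges[OF assms(1), of n] sum_card_lower_nbrs[OF assms(1), of "\<gamma> + k"]
    by (simp add: k algebra_simps)
  moreover have "n - \<gamma> = 2 * \<gamma> + k"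
    by (simp add: k)
  ultimately show ?thesis
    using two[of "2 * \<gamma> + k"] by (simp add: algebra_simps)
qed

section \<open>Isolated vertices and the domination number\<close>

lemma class_graph_no_isolated_vertices:
  assumes "0 < \<gamma>" and "2 * \<gamma> \<le> n"
  shows "no_isolated_vertices {..<n} (class_graph_edges n \<gamma>)"
  unfolding no_isolated_vertices_def
proof
  fix v assume "v \<in> {..<n}"
  show "\<exists>y\<in>{..<n}. {v, y} \<in> class_graph_edges n \<gamma>"
  proof (cases "v < \<gamma>")
    case True
    then show ?thesis
      using assms by (intro bexI[of _ "\<gamma> + v"])
        (auto simp: class_graph_edge_small_iff vertex_class_def)
  next
    case False
    then have "{vertex_class \<gamma> v, v} \<in> class_graph_edges n \<gamma>"
      using vertex_class_less[OF assms(1), of v] \<open>v \<in> {..<n}\<close>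
      by (simp add: class_graph_edge_small_iff)
    then show ?thesis
      using vertex_class_less[OF assms(1), of v] assms(2)
      by (intro bexI[of _ "vertex_class \<gamma> v"]) (auto simp: insert_commute)
  qed
qed

lemma dominating_lessThan:
  assumes "0 < \<gamma>" and "\<gamma> \<le> n"
  shows "dominating_set {..<n} (class_graph_edges n \<gamma>) {..<\<gamma>}"
  using assms vertex_class_less[OF assms(1)]
  by (auto simp: dominating_set_def class_graph_edge_small_iff)

lemma dominating_set_meets_classes:
  assumes "0 < \<gamma>" and "\<gamma> \<le> n" and dom: "dominating_set {..<n} (class_graph_edges n \<gamma>) S"
  shows "vertex_class \<gamma> ` S = {..<\<gamma>}"
proof
  show "vertex_class \<gamma> ` S \<subseteq> {..<\<gamma>}"
    using vertex_class_less[OF assms(1)] by auto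
  show "{..<\<gamma>} \<subseteq> vertex_class \<gamma> ` S"
  proof
    fix i assume i: "i \<in> {..<\<gamma>}"
    show "i \<in> vertex_class \<gamma> ` S"
    proof (cases "i \<in> S")
      case True
      then show ?thesis using i by (auto simp: vertex_class_def intro!: image_eqI[of _ _ i])
    next
      case False
      then obtain u where u: "u \<in> S" "{u, i} \<in> class_graph_edges n \<gamma>"
        using dom i assms(2) unfolding dominating_set_def
        by (metis DiffI lessThan_iff less_le_trans)
      moreover have "u < n"
        using dom u(1) by (auto simp: dominating_set_def)
      ultimately show ?thesis
        using class_graph_edge_small_iff[of i \<gamma> u n] i by (auto simp: insert_commute)
    qed
  qed
qed

lemma dominating_set_card_ge:
  assumes "0 < \<gamma>" and "\<gamma> \<le> n" and "dominating_set {..<n} (class_graph_edges n \<gamma>) S"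
  shows "\<gamma> \<le> card S"
proof -
  have "finite S"
    using assms(3) finite_subset by (auto simp: dominating_set_def)
  then show ?thesis
    using card_image_le[of S "vertex_class \<gamma>"] dominating_set_meets_classes[OF assms] by simp
qed

lemma domination_number_class_graph:
  assumes "0 < \<gamma>" and "\<gamma> \<le> n"
  shows "domination_number {..<n} (class_graph_edges n \<gamma>) = \<gamma>"
  unfolding domination_number_def
proof (rule Min_eqI)
  have "{D. dominating_set {..<n} (class_graph_edges n \<gamma>) D} \<subseteq> Pow {..<n}"
    by (auto simp: dominating_set_def)
  then show "finite (card ` {D. dominating_set {..<n} (class_graph_edges n \<gamma>) D})"
    using finite_subset by blast
  show "\<gamma> \<in> card ` {D. dominating_set {..<n} (class_graph_edges n \<gamma>) D}"
    using dominating_lessThan[OF assms] by (intro image_eqI[of _ _ "{..<\<gamma>}"]) auto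
qed (use dominating_set_card_ge[OF assms] in auto)

section \<open>Uniqueness of the minimum dominating set\<close>

lemma minimum_dominating_set_unique:
  assumes "0 < \<gamma>" and "3 * \<gamma> \<le> n"
    and dom: "dominating_set {..<n} (class_graph_edges n \<gamma>) S" and card: "card S = \<gamma>"
  shows "S = {..<\<gamma>}"
proof -
  have S: "S \<subseteq> {..<n}"
    using dom by (simp add: dominating_set_def)
  then have fin: "finite S"
    using finite_subset by blast
  \<comment> \<open>The \<gamma> elements of \<open>S\<close> are mapped onto \<gamma>
    classes.\<close>
  have "inj_on (vertex_class \<gamma>) S"
    using dominating_set_meets_classes[OF _ _ dom] assms(1,2) card fin
    by (intro eq_card_imp_inj_on) auto
  then have inj: "u = v" if "u \<in> S" "v \<in> S" "vertex_class \<gamma> u = vertex_class \<gamma> v" for u v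
    using that by (auto dest: inj_onD)
  have dominated: "\<exists>u\<in>S. {u, v} \<in> class_graph_edges n \<gamma>" if "v < n" "v \<notin> S" for v
    using dom that by (auto simp: dominating_set_def)
  have no_l: "s < 2 * \<gamma>" if "s \<in> S" for s
  proof (rule ccontr)
    assume "\<not> s < 2 * \<gamma>"
    define L where "L = {s \<in> S. 2 * \<gamma> \<le> s}"
    have "finite (vertex_class \<gamma> ` L)" "vertex_class \<gamma> ` L \<noteq> {}"
      using fin \<open>s \<in> S\<close> \<open>\<not> s < 2 * \<gamma>\<close> by (auto simp: L_def)
    then obtain m where m: "m \<in> L" and max: "\<And>u. u \<in> L \<Longrightarrow> vertex_class \<gamma> u \<le> vertex_class \<gamma> m"
      by (metis (no_types, lifting) Max_ge Max_in imageE imageI)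
    define k where "k = vertex_class \<gamma> m"
    have k: "k < \<gamma>"
      unfolding k_def using assms(1) by (rule vertex_class_less)
    have mS: "m \<in> S" "2 * \<gamma> \<le> m"
      using m by (auto simp: L_def)
    have mk: "vertex_class \<gamma> m = k"
      by (simp add: k_def)
    have ck: "vertex_class \<gamma> (\<gamma> + k) = k" and xk: "vertex_class \<gamma> k = k"
      using k by (auto simp: vertex_class_def)
    have "m \<noteq> \<gamma> + k" "m \<noteq> k"
      using mS(2) k by auto
    then have "\<gamma> + k \<notin> S" "k \<notin> S"
      using inj[OF mS(1)] mk ck xk by metis+
    then obtain u where u: "u \<in> S" "{u, \<gamma> + k} \<in> class_graph_edges n \<gamma>"
      using dominated[of "\<gamma> + k"] k assms(2) by auto
    \<comment> \<open>The neighbours of \<open>c\<^sub>k\<close> are \<open>x\<^sub>k\<close> and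
      the \<open>l\<^sub>t\<close> of class strictly above \<open>k\<close>; the former is not in
      \<open>S\<close>, the latter contradict the maximality of \<open>k\<close>.\<close>
    then have "2 * \<gamma> \<le> u \<and> k < vertex_class \<gamma> u"
      using \<open>k \<notin> S\<close> k ck vertex_class_less[OF assms(1), of u]
      by (auto simp: class_graph_edge_iff lower_nbrs_def split: if_splits)
    then show False
      using max[of u] u(1) mk by (simp add: L_def)
  qed
  have "s < \<gamma>" if "s \<in> S" for s
  proof (rule ccontr)
    assume "\<not> s < \<gamma>"
    \<comment> \<open>By \<open>no_l\<close>, this is the \<open>c\<^sub>k\<close> in
      \<open>S\<close> with least index.\<close>
    define m where "m = (LEAST s. s \<in> S \<and> \<gamma> \<le> s)"
    have m: "m \<in> S" "\<gamma> \<le> m"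
      using LeastI[of "\<lambda>s. s \<in> S \<and> \<gamma> \<le> s" s] \<open>s \<in> S\<close> \<open>\<not> s < \<gamma>\<close> by (auto simp: m_def)
    have least: "m \<le> u" if "u \<in> S" "\<gamma> \<le> u" for u
      unfolding m_def using that by (auto intro: Least_le)
    define k where "k = m - \<gamma>"
    have k: "k < \<gamma>" "m = \<gamma> + k"
      using no_l[OF m(1)] m(2) by (auto simp: k_def)
    have ck: "vertex_class \<gamma> m = k" and xk: "vertex_class \<gamma> k = k"
      and lk: "vertex_class \<gamma> (2 * \<gamma> + k) = k"
      using k by (auto simp: vertex_class_def)
    have "k \<notin> S"
      using inj[OF m(1), of k] ck xk k by auto
    moreover have "2 * \<gamma> + k \<notin> S"
      using no_l[of "2 * \<gamma> + k"] by auto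
    \<comment> \<open>As \<open>3 * \<gamma> \<le> n\<close>, the vertex \<open>l\<^sub>k\<close>
      exists for every \<open>k < \<gamma>\<close>.\<close>
    then obtain u where u: "u \<in> S" "{u, 2 * \<gamma> + k} \<in> class_graph_edges n \<gamma>"
      using dominated[of "2 * \<gamma> + k"] k assms(2) by auto
    \<comment> \<open>With \<open>x\<^sub>k\<close> and all \<open>l\<^sub>t\<close> outside
      \<open>S\<close>, only some \<open>c\<^sub>i\<close> with \<open>i < k\<close> can dominate
      \<open>l\<^sub>k\<close>.\<close>
    ultimately have "\<gamma> \<le> u \<and> u < m"
      using k lk no_l[OF u(1)] vertex_class_less[OF assms(1), of u]
      by (auto simp: class_graph_edge_iff lower_nbrs_def split: if_splits)
    then show False
      using least[of u] u(1) by auto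
  qed
  then show ?thesis
    using card by (intro card_subset_eq) auto
qed

text \<open>The neighbourhoods of the \<open>x\<^sub>i\<close> are the classes without
  \<open>x\<^sub>i\<close>, and these partition \<open>{\<gamma>..<n}\<close>.\<close>

lemma class_graph_degree_sum:
  assumes "0 < \<gamma>"
  shows "(\<Sum>i<\<gamma>. degree {..<n} (class_graph_edges n \<gamma>) i) = n - \<gamma>"
proof -
  have "(\<Sum>i<\<gamma>. degree {..<n} (class_graph_edges n \<gamma>) i) =
      (\<Sum>i<\<gamma>. card {v \<in> {\<gamma>..<n}. vertex_class \<gamma> v = i})"
    unfolding degree_def
    by (intro sum.cong refl arg_cong[where f = card]) (auto simp: class_graph_edge_small_iff)
  also have "\<dots> = (\<Sum>v\<in>{\<gamma>..<n}. 1)"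
    using sum.group[of "{\<gamma>..<n}" "{..<\<gamma>}" "vertex_class \<gamma>" "\<lambda>_. 1 :: nat"]
      vertex_class_less[OF assms] by auto
  finally show ?thesis by simp
qed

theorem theorem2p12:
  fixes n \<gamma> :: nat
  assumes "\<gamma> \<ge> 2" and "n \<ge> 3 * \<gamma>"
  shows "\<exists>(V :: nat set) E. (V, E) \<in> unique_mds_graphs n \<gamma> \<and> perfectly_dominated V E \<and>
           int (card E) = int ((n - \<gamma>) choose 2) - int \<gamma> * (int \<gamma> - 2)"
proof -
  let ?V = "{..<n}" and ?E = "class_graph_edges n \<gamma>"
  have pos: "0 < \<gamma>" and le: "\<gamma> \<le> n" "2 * \<gamma> \<le> n"
    using assms by auto
  note number = domination_number_class_graph[OF pos le(1)]
  have mds: "minimum_dominating_set ?V ?E D \<longleftrightarrow> D = {..<\<gamma>}" for D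
    using minimum_dominating_set_unique[OF pos assms(2), of D] dominating_lessThan[OF pos le(1)] number
    by (auto simp: minimum_dominating_set_def)
  have graph: "simple_graph ?V ?E" "no_isolated_vertices ?V ?E"
    by (rule simple_class_graph[OF pos], rule class_graph_no_isolated_vertices[OF pos le(2)])
  have "(?V, ?E) \<in> unique_mds_graphs n \<gamma>"
    using graph number by (auto simp: unique_mds_graphs_def mds)
  moreover have "perfectly_dominated ?V ?E"
    using graph number mds class_graph_degree_sum[OF pos] by (simp add: perfectly_dominated_def)
  ultimately show ?thesis
    using card_class_graph_edges_eq[OF pos assms(2)] by blast
qed

end
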